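(* Let $\tilde{x}$ be an optimal solution of LP-($L_0$) below, let $\{\mathcal{P}^{(t)}\}_{1\le t\le\ell}$ be the output of the algorithm Ultrametric-Violation-Distance$(\tilde{x})$ described below, and let $\hat{x}$ be the corresponding integral distance function: for $1\le t\le\ell$, $\hat{x}^{(t)}_{\{u,v\}}=0$ if $u,v$ lie in the same part of $\mathcal{P}^{(t)}$ and $\hat{x}^{(t)}_{\{u,v\}}=1$ otherwise, and $\hat{x}^{(\ell+1)}_{\{u,v\}}:=0$. Then $$\sum_{\{u,v\}\in\binom{V}{2}}\Bigl(\bigl(1-\hat{x}^{(t_{\{u,v\}})}_{\{u,v\}}\bigr)+\hat{x}^{(t_{\{u,v\}}+1)}_{\{u,v\}}\Bigr)\;\le\;5\sum_{\{u,v\}\in\binom{V}{2}}\Bigl(\bigl(1-\tilde{x}^{(t_{\{u,v\}})}_{\{u,v\}}\bigr)+\tilde{x}^{(t_{\{u,v\}}+1)}_{\{u,v\}}\Bigr).$$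
   Context: Setting: a finite set $V$, an integer $\ell\ge1$, and for each pair $\{u,v\}\in\binom{V}{2}$ a prescribed layer index $t_{\{u,v\}}\in\{1,\dots,\ell\}$ (the layer at which $u,v$ are supposed to be separated). LP-($L_0$) has variables $x^{(t)}_{\{u,v\}}$ for $1\le t\le\ell$, with conventions $x^{(t)}_{\{u,u\}}=0$ and $x^{(\ell+1)}_{\{u,v\}}:=0$; it minimizes $\sum_{\{u,v\}}\bigl((1-x^{(t_{\{u,v\}})}_{\{u,v\}})+x^{(t_{\{u,v\}}+1)}_{\{u,v\}}\bigr)$ subject to $x^{(t)}_{\{u,v\}}\le x^{(t)}_{\{u,p\}}+x^{(t)}_{\{p,v\}}$ for all $t$ and $u,v,p\in V$, and $0\le x^{(t+1)}_{\{u,v\}}\le x^{(t)}_{\{u,v\}}\le1$ for $1\le t<\ell$. For a distance function $x$, a set $P$ and $v\in P$: $\mathrm{Ball}_{<r}(v,P):=\{q\in P:x_{\{v,q\}}<r\}$ and $\mathrm{diam}(P):=\max_{u,w\in P}x_{\{u,w\}}$. Algorithm Ultrametric-Violation-Distance$(\tilde{x})$: set $\mathcal{P}^{(\ell+1)}=\{V\}$; for $t=\ell$ down to $1$: set $\mathcal{P}^{(t)}:=\mathcal{P}^{(t+1)}$, and while some $P\in\mathcal{P}^{(t)}$ has diameter at least $1/2$ with respect to $\tilde{x}^{(t)}$, pick $P\in\mathcal{P}^{(t)}$ and $v\in P$ with $\max_{u\in P}\tilde{x}^{(t)}_{\{u,v\}}\ge1/2$ and replace $P$ by the two sets returned by One-Half-Refine-Cut$(P,v,\tilde{x}^{(t)})$;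 return $\{\mathcal{P}^{(t)}\}_{1\le t\le\ell}$. One-Half-Refine-Cut$(P,v,x)$: if $\sum_{q\in\mathrm{Ball}_{<1/2}(v,P)}x_{\{v,q\}}\ge\frac12|\mathrm{Ball}_{<1/2}(v,P)|-\frac14|\mathrm{Ball}_{<3/4}(v,P)|-\frac14$, return $(\{v\},P\setminus\{v\})$; otherwise return $(\mathrm{Ball}_{<1/2}(v,P),\,P\setminus\mathrm{Ball}_{<1/2}(v,P))$. *)

theory Defs
  imports Complex_Main
begin

text \<open>
  A family of distance functions is a function \<open>x\<close> of a layer and an unordered pair: the value
  \<open>x t {u, v}\<close> stands for $x^{(t)}_{\{u,v\}}$. For \<open>u = v\<close> the set \<open>{u, v}\<close> is the singleton
  \<open>{u}\<close>. The map \<open>\<tau>\<close> gives the prescribed layer of each pair.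
\<close>

definition pairs :: "'a set \<Rightarrow> 'a set set" where
  "pairs V = {e. e \<subseteq> V \<and> card e = 2}"

definition L0_objective ::
    "'a set \<Rightarrow> ('a set \<Rightarrow> nat) \<Rightarrow> (nat \<Rightarrow> 'a set \<Rightarrow> real) \<Rightarrow> real" where
  "L0_objective V \<tau> x = (\<Sum>e\<in>pairs V. (1 - x (\<tau> e) e) + x (\<tau> e + 1) e)"

text \<open>
  The first two conjuncts are the conventions on $x^{(t)}_{\{u,u\}}$ and on layer \<open>L + 1\<close>.
  The chain of inequalities in the last conjunct is also imposed at \<open>t = L\<close>, where it reads
  $0 \le x^{(L)} \le 1$. For \<open>L \<ge> 2\<close> this is implied by the inequalities for \<open>t < L\<close>;
  for \<open>L = 1\<close> it is what bounds the variables.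
\<close>

definition L0_feasible :: "'a set \<Rightarrow> nat \<Rightarrow> (nat \<Rightarrow> 'a set \<Rightarrow> real) \<Rightarrow> bool" where
  "L0_feasible V L x \<longleftrightarrow>
     (\<forall>t\<in>{1..L}. \<forall>u\<in>V. x t {u, u} = 0) \<and>
     (\<forall>u\<in>V. \<forall>v\<in>V. x (L + 1) {u, v} = 0) \<and>
     (\<forall>t\<in>{1..L}. \<forall>u\<in>V. \<forall>v\<in>V. \<forall>p\<in>V. x t {u, v} \<le> x t {u, p} + x t {p, v}) \<and>
     (\<forall>t\<in>{1..L}. \<forall>u\<in>V. \<forall>v\<in>V.
        0 \<le> x (t + 1) {u, v} \<and> x (t + 1) {u, v} \<le> x t {u, v} \<and> x t {u, v} \<le> 1)"

definition L0_optimal ::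
    "'a set \<Rightarrow> nat \<Rightarrow> ('a set \<Rightarrow> nat) \<Rightarrow> (nat \<Rightarrow> 'a set \<Rightarrow> real) \<Rightarrow> bool" where
  "L0_optimal V L \<tau> x \<longleftrightarrow>
     L0_feasible V L x \<and> (\<forall>y. L0_feasible V L y \<longrightarrow> L0_objective V \<tau> x \<le> L0_objective V \<tau> y)"

definition ball_lt :: "('a set \<Rightarrow> real) \<Rightarrow> real \<Rightarrow> 'a \<Rightarrow> 'a set \<Rightarrow> 'a set" where
  "ball_lt d r v P = {q \<in> P. d {v, q} < r}"

definition diam :: "('a set \<Rightarrow> real) \<Rightarrow> 'a set \<Rightarrow> real" where
  "diam d P = Max {d {u, w} | u w. u \<in> P \<and> w \<in> P}"

definition one_half_refine_cut ::
    "'a set \<Rightarrow> 'a \<Rightarrow> ('a set \<Rightarrow> real) \<Rightarrow> 'a set \<times> 'a set" where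
  "one_half_refine_cut P v d =
     (if (\<Sum>q\<in>ball_lt d (1/2) v P. d {v, q})
           \<ge> 1/2 * real (card (ball_lt d (1/2) v P)) - 1/4 * real (card (ball_lt d (3/4) v P)) - 1/4
      then ({v}, P - {v})
      else (ball_lt d (1/2) v P, P - ball_lt d (1/2) v P))"

text \<open>
  \<open>refine_loop d Q R\<close>: some execution of the while loop with distance function \<open>d\<close>, started in
  the partition \<open>Q\<close>, terminates in the partition \<open>R\<close>. The choice of \<open>P\<close> and \<open>v\<close> in each
  iteration is arbitrary, so this is a relation.
\<close>

inductive refine_loop :: "('a set \<Rightarrow> real) \<Rightarrow> 'a set set \<Rightarrow> 'a set set \<Rightarrow> bool"
  for d :: "'a set \<Rightarrow> real" where
  exit: "\<not> (\<exists>P\<in>Q. diam d P \<ge> 1/2) \<Longrightarrow> refine_loop d Q Q"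
| iterate: "\<lbrakk> \<exists>P'\<in>Q. diam d P' \<ge> 1/2;
     P \<in> Q; v \<in> P; Max {d {u, v} | u. u \<in> P} \<ge> 1/2;
     one_half_refine_cut P v d = (A, B);
     refine_loop d ((Q - {P}) \<union> {A, B}) R \<rbrakk> \<Longrightarrow> refine_loop d Q R"

definition ultrametric_violation_distance_output ::
    "'a set \<Rightarrow> nat \<Rightarrow> (nat \<Rightarrow> 'a set \<Rightarrow> real) \<Rightarrow> (nat \<Rightarrow> 'a set set) \<Rightarrow> bool" where
  "ultrametric_violation_distance_output V L x \<P> \<longleftrightarrow>
     \<P> (L + 1) = {V} \<and> (\<forall>t\<in>{1..L}. refine_loop (x t) (\<P> (t + 1)) (\<P> t))"

definition integral_distance :: "nat \<Rightarrow> (nat \<Rightarrow> 'a set set) \<Rightarrow> nat \<Rightarrow> 'a set \<Rightarrow> real" where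
  "integral_distance L \<P> t e =
     (if t = L + 1 then 0 else if \<exists>S\<in>\<P> t. e \<subseteq> S then 0 else 1)"

end

theory Submission
  imports Defs
begin

text \<open>
  Every pair pays at most \<open>1\<close> in the integral solution. Let \<open>w e\<close> be five times the LP
  contribution of \<open>e\<close> minus its integral cost. If \<open>e\<close> is first separated in layer \<open>s\<close> and
  \<open>z = x s e\<close>, then \<open>w e\<close> is at least \<open>charge z = min (5 z - 1) (min (3/2) (5 - 5 z))\<close>:
  \<^item> if \<open>\<tau> e < s\<close>, the cost is \<open>1\<close> and the LP pays at least \<open>z\<close> by monotonicity in the layer;
  \<^item> if \<open>\<tau> e = s\<close>, the cost is \<open>0\<close> and the LP pays at least \<open>1 - z\<close>;
  \<^item> if \<open>\<tau> e > s\<close>, the pair survives layer \<open>\<tau> e\<close> inside a part of diameter below \<open>1/2\<close>, so the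
    cost is \<open>1\<close> and the LP pays at least \<open>1/2\<close>.

  The rule of One-Half-Refine-Cut makes the total charge of the pairs crossing any single cut
  nonnegative. Summing over all cuts, and adding the pairs that are never separated (whose LP
  contribution is at least \<open>1/2\<close>), bounds the integral cost by five times the LP value.
\<close>

section \<open>Charge of a single cut\<close>

definition charge :: "real \<Rightarrow> real" where
  "charge z = min (5 * z - 1) (min (3/2) (5 - 5 * z))"

text \<open>Isolates what one layer of a feasible LP solution provides. Symmetry is built in,
  because \<open>d\<close> is applied to unordered pairs.\<close>

locale unit_pseudometric =
  fixes V :: "'a set" and d :: "'a set \<Rightarrow> real"
  assumes finite_V: "finite V"
    and refl: "u \<in> V \<Longrightarrow> d {u, u} = 0"
    and triangle: "\<lbrakk>u \<in> V; v \<in> V; p \<in> V\<rbrakk> \<Longrightarrow> d {u, v} \<le> d {u, p} + d {p, v}"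
    and nonneg: "\<lbrakk>u \<in> V; v \<in> V\<rbrakk> \<Longrightarrow> 0 \<le> d {u, v}"
    and le_one: "\<lbrakk>u \<in> V; v \<in> V\<rbrakk> \<Longrightarrow> d {u, v} \<le> 1"
begin

text \<open>Five times the test inequality bounds the sum of the minorant \<open>f\<close> over
  \<open>P\<close> below by (b - 5)/4, where b is the size of the ball of radius 1/2. Removing the
  contribution -1 of \<open>v\<close> itself leaves (b - 1)/4, and b is at least 1.\<close>

lemma singleton_cut_charge_nonneg:
  assumes P: "P \<subseteq> V" and v: "v \<in> P"
    and far: "(\<Sum>q\<in>ball_lt d (1/2) v P. d {v, q})
      \<ge> 1/2 * real (card (ball_lt d (1/2) v P)) - 1/4 * real (card (ball_lt d (3/4) v P)) - 1/4"
  shows "0 \<le> (\<Sum>q\<in>P - {v}. charge (d {v, q}))"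
proof -
  \<comment> \<open>For arguments at most 1, \<open>f\<close> is a minorant of
    \<open>charge\<close>: it is 5 z - 1 below 1/2, then 5/4 up to 3/4, then 0. Splitting it at the
    two radii turns its sum into exactly the quantities in the test of the cut rule.\<close>
  define f where "f z = (if z < 1/2 then 5 * z - 9/4 else 0) + (if z < 3/4 then 5/4 else (0::real))" for z
  have fin: "finite P" using P finite_V by (rule finite_subset)
  have "f z \<le> charge z" if "z \<le> 1" for z
    using that by (auto simp: f_def charge_def)
  then have "(\<Sum>q\<in>P - {v}. f (d {v, q})) \<le> (\<Sum>q\<in>P - {v}. charge (d {v, q}))"
    using P v by (intro sum_mono) (auto intro: le_one)
  moreover have "(\<Sum>q\<in>P. f (d {v, q})) = f (d {v, v}) + (\<Sum>q\<in>P - {v}. f (d {v, q}))"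
    using fin v by (rule sum.remove)
  moreover have "f (d {v, v}) = -1"
    using refl[of v] P v by (auto simp: f_def)
  moreover have "(\<Sum>q\<in>P. f (d {v, q})) =
      (\<Sum>q\<in>ball_lt d (1/2) v P. 5 * d {v, q} - 9/4) + (\<Sum>q\<in>ball_lt d (3/4) v P. 5/4)"
    unfolding f_def ball_lt_def sum.distrib using fin by (simp only: sum.inter_filter)
  moreover have "\<dots> = 5 * (\<Sum>q\<in>ball_lt d (1/2) v P. d {v, q})
      - 9/4 * real (card (ball_lt d (1/2) v P)) + 5/4 * real (card (ball_lt d (3/4) v P))"
    by (simp add: sum_subtractf sum_distrib_left)
  moreover have "card (ball_lt d (1/2) v P) \<ge> 1"
  proof -
    have "v \<in> ball_lt d (1/2) v P" using refl[of v] P v by (auto simp: ball_lt_def)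
    moreover have "finite (ball_lt d (1/2) v P)" using fin by (simp add: ball_lt_def)
    ultimately show ?thesis by (metis One_nat_def Suc_leI card_gt_0_iff empty_iff)
  qed
  then have "real (card (ball_lt d (1/2) v P)) \<ge> 1" by linarith
  ultimately show ?thesis using far by linarith
qed

text \<open>The charge is already nonnegative for each outside point \<open>p\<close> separately.
  Only points \<open>p\<close> at distance below 3/4 from \<open>v\<close> require the failed test;
  for the others every single pair has nonnegative charge.\<close>

lemma ball_cut_charge_nonneg:
  assumes P: "P \<subseteq> V" and v: "v \<in> P" and p: "p \<in> P - ball_lt d (1/2) v P"
    and near: "(\<Sum>q\<in>ball_lt d (1/2) v P. d {v, q})
      < 1/2 * real (card (ball_lt d (1/2) v P)) - 1/4 * real (card (ball_lt d (3/4) v P)) - 1/4"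
  shows "0 \<le> (\<Sum>q\<in>ball_lt d (1/2) v P. charge (d {q, p}))"
proof -
  let ?B = "ball_lt d (1/2) v P"
  have y: "d {v, p} \<ge> 1/2" using p by (auto simp: ball_lt_def)
  have facts: "d {v, p} \<le> d {v, q} + d {q, p}" "d {q, p} \<le> d {v, q} + d {v, p}"
    "d {q, p} \<le> 1" "0 \<le> d {v, q}" "d {v, q} < 1/2" if "q \<in> ?B" for q
  proof -
    have V: "q \<in> V" "v \<in> V" "p \<in> V" using that P v p by (auto simp: ball_lt_def)
    show "d {v, p} \<le> d {v, q} + d {q, p}" using triangle V by blast
    show "d {q, p} \<le> d {v, q} + d {v, p}"
      using triangle[of q p v] V by (simp add: insert_commute)
    show "d {q, p} \<le> 1" "0 \<le> d {v, q}" using V le_one nonneg by auto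
    show "d {v, q} < 1/2" using that by (simp add: ball_lt_def)
  qed
  show ?thesis
  proof (cases "d {v, p} \<ge> 3/4")
    case True
    \<comment> \<open>The triangle inequality gives \<open>d {q, p}\<close> > 3/4 - 1/2 = 1/4, so 5
      z - 1 is positive; 5 - 5 z is nonnegative since distances are at most 1.\<close>
    have "0 \<le> charge (d {q, p})" if "q \<in> ?B" for q
      using facts[OF that] True by (auto simp: charge_def)
    then show ?thesis by (rule sum_nonneg)
  next
    case False
    \<comment> \<open>The constant 5/4 comes from the branch 5 - 5 z with z at most
      \<open>d {v, q}\<close> + \<open>d {v, p}\<close> and \<open>d {v, p}\<close> < 3/4; the
      branch 5 z - 1 would even allow 3/2.\<close>
    have "5/4 - 5 * d {v, q} \<le> charge (d {q, p})" if "q \<in> ?B" for q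
      using facts[OF that] y False by (auto simp: charge_def)
    then have "(\<Sum>q\<in>?B. 5/4 - 5 * d {v, q}) \<le> (\<Sum>q\<in>?B. charge (d {q, p}))"
      by (rule sum_mono)
    moreover have "(\<Sum>q\<in>?B. 5/4 - 5 * d {v, q}) = 5/4 * real (card ?B) - 5 * (\<Sum>q\<in>?B. d {v, q})"
      by (simp add: sum_subtractf sum_distrib_left)
    moreover have "card ?B \<le> card (ball_lt d (3/4) v P)"
      using finite_subset[OF P finite_V] by (intro card_mono) (auto simp: ball_lt_def)
    then have "real (card ?B) \<le> real (card (ball_lt d (3/4) v P))" by simp
    ultimately show ?thesis using near by linarith
  qed
qed

lemma one_half_refine_cut_partition:
  assumes "v \<in> P" and "one_half_refine_cut P v d = (A, B)"
  shows "A \<union> B = P" and "A \<inter> B = {}"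
  using assms by (auto simp: one_half_refine_cut_def ball_lt_def split: if_splits)

lemma one_half_refine_cut_charge_nonneg:
  assumes P: "P \<subseteq> V" and v: "v \<in> P" and cut: "one_half_refine_cut P v d = (A, B)"
  shows "0 \<le> (\<Sum>a\<in>A. \<Sum>b\<in>B. charge (d {a, b}))"
proof (cases "(\<Sum>q\<in>ball_lt d (1/2) v P. d {v, q})
      \<ge> 1/2 * real (card (ball_lt d (1/2) v P)) - 1/4 * real (card (ball_lt d (3/4) v P)) - 1/4")
  case True
  then have "A = {v}" "B = P - {v}" using cut by (auto simp: one_half_refine_cut_def)
  then show ?thesis using singleton_cut_charge_nonneg[OF P v True] by simp
next
  case False
  then have AB: "A = ball_lt d (1/2) v P" "B = P - ball_lt d (1/2) v P"
    using cut by (auto simp: one_half_refine_cut_def)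
  \<comment> \<open>The outside point has to be the outer index, since nonnegativity is known for
    the sum over the ball with that point fixed.\<close>
  have "0 \<le> (\<Sum>b\<in>B. \<Sum>a\<in>A. charge (d {a, b}))"
    unfolding AB using False by (intro sum_nonneg ball_cut_charge_nonneg[OF P v]) auto
  then show ?thesis by (subst sum.swap)
qed

end

section \<open>Pairs kept together or separated by the refinement loop\<close>

definition joined :: "'a set set \<Rightarrow> 'a set \<Rightarrow> bool" where
  "joined Q e \<longleftrightarrow> (\<exists>S\<in>Q. e \<subseteq> S)"

lemma finite_pairs: "finite V \<Longrightarrow> finite (pairs V)"
  by (rule finite_subset[of _ "Pow V"]) (auto simp: pairs_def)

lemma pairsE:
  assumes "e \<in> pairs V"
  obtains u v where "e = {u, v}" "u \<in> V" "v \<in> V" "u \<noteq> v"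
  using assms by (auto simp: pairs_def card_2_iff)

lemma joined_split:
  assumes "joined (Q - {P} \<union> {A, B}) e" and "P \<in> Q" and "A \<union> B = P"
  shows "joined Q e"
  using assms unfolding joined_def by blast

lemma refine_loop_joined:
  assumes "refine_loop d Q R" and "joined R e"
  shows "joined Q e"
  using assms
proof (induction rule: refine_loop.induct)
  case (iterate Q P v A B R)
  have "A \<union> B = P"
    using iterate.hyps(3,5)
    by (auto simp: one_half_refine_cut_def ball_lt_def split: if_splits)
  with iterate.IH iterate.prems iterate.hyps(2) show ?case by (blast intro: joined_split)
qed

text \<open>Identifies the pairs paid for by one cut, so that the double sum over \<open>A\<close>
  and \<open>B\<close> becomes a sum over pairs. Disjointness of the parts ensures that no other
  part still contains both ends of a crossing pair.\<close>

lemma separated_by_split: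
  assumes disj: "pairwise disjnt Q" and sub: "\<Union>Q \<subseteq> V" and PQ: "P \<in> Q"
    and AB: "A \<union> B = P" "A \<inter> B = {}"
  shows "{e \<in> pairs V. joined Q e \<and> \<not> joined (Q - {P} \<union> {A, B}) e} = (\<lambda>(a, b). {a, b}) ` (A \<times> B)"
    (is "?L = ?R")
proof
  show "?L \<subseteq> ?R"
  proof
    fix e assume "e \<in> ?L"
    then have e: "e \<in> pairs V" "joined Q e" "\<not> joined (Q - {P} \<union> {A, B}) e" by auto
    then have "e \<subseteq> P" "\<not> e \<subseteq> A" "\<not> e \<subseteq> B" by (auto simp: joined_def)
    moreover obtain u v where uv: "e = {u, v}" using e(1) by (rule pairsE)
    ultimately have "(u \<in> A \<and> v \<in> B) \<or> (v \<in> A \<and> u \<in> B)" using AB by auto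
    then show "e \<in> ?R" unfolding uv by (auto simp: insert_commute image_iff)
  qed
  show "?R \<subseteq> ?L"
  proof clarify
    fix a b assume ab: "a \<in> A" "b \<in> B"
    then have P: "a \<in> P" "b \<in> P" "a \<noteq> b" using AB by auto
    have "{a, b} \<in> pairs V" using P PQ sub by (auto simp: pairs_def)
    moreover have "joined Q {a, b}" using P PQ by (auto simp: joined_def)
    moreover have "S = P" if "S \<in> Q" "a \<in> S" for S
      using disj that P(1) PQ by (meson disjnt_iff pairwiseD)
    then have "\<not> joined (Q - {P} \<union> {A, B}) {a, b}"
      using ab AB(2) by (auto simp: joined_def)
    ultimately show "{a, b} \<in> pairs V \<and> joined Q {a, b} \<and> \<not> joined (Q - {P} \<union> {A, B}) {a, b}"
      by blast
  qed
qed

lemma pairwise_disjnt_split: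
  assumes "pairwise disjnt Q" and "P \<in> Q" and "A \<union> B = P" and "A \<inter> B = {}"
  shows "pairwise disjnt (Q - {P} \<union> {A, B})"
proof -
  have "disjnt S A \<and> disjnt S B \<and> disjnt A S \<and> disjnt B S" if "S \<in> Q - {P}" for S
  proof -
    have "disjnt S P" using assms(1,2) that by (auto simp: pairwise_def)
    then show ?thesis using assms(3) by (auto simp: disjnt_def)
  qed
  then show ?thesis using assms(1,4) by (auto simp: pairwise_def disjnt_def Int_commute)
qed

context unit_pseudometric
begin

text \<open>Passes from one cut to a whole run of the loop: the pairs separated by the run are those
  crossing the first cut together with those separated later. The weight \<open>w\<close> is kept
  abstract so that it can be the same in all layers.\<close>

lemma refine_loop_weight_nonneg:
  assumes "refine_loop d Q R" and "pairwise disjnt Q" and "\<Union>Q \<subseteq> V"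
    and "\<And>e. \<lbrakk>e \<in> pairs V; joined Q e; \<not> joined R e\<rbrakk> \<Longrightarrow> charge (d e) \<le> w e"
  shows "pairwise disjnt R \<and> \<Union>R \<subseteq> V \<and> 0 \<le> (\<Sum>e\<in>{e \<in> pairs V. joined Q e \<and> \<not> joined R e}. w e)"
  using assms
proof (induction rule: refine_loop.induct)
  case (exit Q)
  then show ?case by simp
next
  case (iterate Q P v A B R)
  let ?Q = "Q - {P} \<union> {A, B}"
  have PV: "P \<subseteq> V" using iterate by blast
  note AB = one_half_refine_cut_partition[OF iterate.hyps(3,5)]
  have QR: "joined ?Q e" if "joined R e" for e
    using iterate.hyps(6) that by (rule refine_loop_joined)
  have QQ: "joined Q e" if "joined ?Q e" for e
    using that iterate.hyps(2) AB(1) by (rule joined_split)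
  have IH: "pairwise disjnt R \<and> \<Union>R \<subseteq> V \<and> 0 \<le> (\<Sum>e\<in>{e \<in> pairs V. joined ?Q e \<and> \<not> joined R e}. w e)"
  proof (rule iterate.IH)
    show "pairwise disjnt ?Q"
      using iterate.prems(1) iterate.hyps(2) AB by (rule pairwise_disjnt_split)
    show "\<Union>?Q \<subseteq> V" using iterate.prems(2) AB(1) PV by auto
    show "charge (d e) \<le> w e" if "e \<in> pairs V" "joined ?Q e" "\<not> joined R e" for e
      using iterate.prems(3) that QQ by blast
  qed
  let ?C = "{e \<in> pairs V. joined Q e \<and> \<not> joined ?Q e}"
  note C = separated_by_split[OF iterate.prems(1,2) iterate.hyps(2) AB]
  \<comment> \<open>Disjointness of \<open>A\<close> and \<open>B\<close> fixes which end of a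
    crossing pair lies on which side, so each pair is counted once.\<close>
  have inj: "inj_on (\<lambda>(a, b). {a, b}) (A \<times> B)"
    using AB(2) by (auto simp: inj_on_def doubleton_eq_iff)
  have "0 \<le> (\<Sum>a\<in>A. \<Sum>b\<in>B. charge (d {a, b}))"
    using PV iterate.hyps(3,5) by (rule one_half_refine_cut_charge_nonneg)
  also have "\<dots> = (\<Sum>e\<in>?C. charge (d e))"
    unfolding C sum.reindex[OF inj] by (simp add: sum.cartesian_product case_prod_unfold)
  \<comment> \<open>A pair cut now is never rejoined, so it is separated in \<open>R\<close> as well
    and the assumed bound on its charge applies.\<close>
  also have "\<dots> \<le> (\<Sum>e\<in>?C. w e)"
    using iterate.prems(3) QR by (intro sum_mono) blast
  finally have "0 \<le> (\<Sum>e\<in>?C. w e)" .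
  moreover have "{e \<in> pairs V. joined Q e \<and> \<not> joined R e}
      = ?C \<union> {e \<in> pairs V. joined ?Q e \<and> \<not> joined R e}"
    using QR QQ by blast
  then have "(\<Sum>e\<in>{e \<in> pairs V. joined Q e \<and> \<not> joined R e}. w e)
      = (\<Sum>e\<in>?C. w e) + (\<Sum>e\<in>{e \<in> pairs V. joined ?Q e \<and> \<not> joined R e}. w e)"
    using finite_pairs[OF finite_V] by (simp only:) (rule sum.union_disjoint, auto)
  ultimately show ?case using IH by linarith
qed

end

section \<open>Surviving pairs are at distance below 1/2\<close>

lemma refine_loop_diam: "refine_loop d Q R \<Longrightarrow> S \<in> R \<Longrightarrow> diam d S < 1/2"
  by (induction rule: refine_loop.induct) auto

lemma le_diam:
  assumes "finite S" and "u \<in> S" and "v \<in> S"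
  shows "d {u, v} \<le> diam d S"
proof -
  have "{d {u, w} | u w. u \<in> S \<and> w \<in> S} = (\<lambda>(u, w). d {u, w}) ` (S \<times> S)" by auto
  then have "finite {d {u, w} | u w. u \<in> S \<and> w \<in> S}" using assms(1) by simp
  then show ?thesis unfolding diam_def using assms(2,3) by (auto intro!: Max_ge)
qed

lemma refine_loop_joined_less_half:
  assumes "refine_loop d Q R" and "joined R e" and "e \<in> pairs V" and "\<Union>R \<subseteq> V" and "finite V"
  shows "d e < 1/2"
proof -
  obtain S where S: "S \<in> R" "e \<subseteq> S" using assms(2) by (auto simp: joined_def)
  obtain u v where "e = {u, v}" using assms(3) by (rule pairsE)
  moreover have "finite S" using S(1) assms(4,5) by (meson Sup_upper finite_subset order_trans)
  ultimately have "d e \<le> diam d S" using S(2) le_diam by fastforce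
  then show ?thesis using refine_loop_diam[OF assms(1) S(1)] by simp
qed

section \<open>Layers of a feasible LP solution\<close>

lemma L0_feasible_unit_pseudometric:
  assumes "L0_feasible V L x" and "finite V" and "t \<in> {1..L}"
  shows "unit_pseudometric V (x t)"
proof
  show "0 \<le> x t {u, v}" if "u \<in> V" "v \<in> V" for u v
    using assms(1,3) that unfolding L0_feasible_def by (meson order_trans)
qed (use assms in \<open>auto simp: L0_feasible_def\<close>)

lemma L0_feasible_antimono:
  assumes "L0_feasible V L x" and "e \<in> pairs V" and "1 \<le> s" and "s \<le> t" and "t \<le> L + 1"
  shows "x t e \<le> x s e"
  using assms(4,5)
proof (induction t rule: dec_induct)
  case (step n)
  obtain u v where "e = {u, v}" "u \<in> V" "v \<in> V" using assms(2) by (rule pairsE)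
  then have "x (n + 1) e \<le> x n e" using assms(1,3) step unfolding L0_feasible_def by auto
  then show ?case using step by simp
qed simp

lemma L0_feasible_bounds:
  assumes "L0_feasible V L x" and "e \<in> pairs V" and "t \<in> {1..L}"
  shows "x t e \<le> 1" and "0 \<le> x (t + 1) e"
proof -
  obtain u v where "e = {u, v}" "u \<in> V" "v \<in> V" using assms(2) by (rule pairsE)
  then show "x t e \<le> 1" "0 \<le> x (t + 1) e" using assms(1,3) unfolding L0_feasible_def by auto
qed

section \<open>Accumulating the weights over all layers\<close>

theorem theorem2:
  fixes V :: "'a set"
    and L :: nat
    and \<tau> :: "'a set \<Rightarrow> nat"
    and x :: "nat \<Rightarrow> 'a set \<Rightarrow> real"
    and \<P> :: "nat \<Rightarrow> 'a set set"
  assumes "finite V"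
    and "L \<ge> 1"
    and "\<And>e. e \<in> pairs V \<Longrightarrow> \<tau> e \<in> {1..L}"
    and "L0_optimal V L \<tau> x"
    and "ultrametric_violation_distance_output V L x \<P>"
  shows "(\<Sum>e\<in>pairs V. (1 - integral_distance L \<P> (\<tau> e) e) + integral_distance L \<P> (\<tau> e + 1) e)
      \<le> 5 * (\<Sum>e\<in>pairs V. (1 - x (\<tau> e) e) + x (\<tau> e + 1) e)"
proof -
  let ?J = "\<lambda>t e. joined (\<P> t) e"
  define lp where "lp e = (1 - x (\<tau> e) e) + x (\<tau> e + 1) e" for e
  define cost where
    "cost e = (1 - integral_distance L \<P> (\<tau> e) e) + integral_distance L \<P> (\<tau> e + 1) e" for e
  define w where "w e = 5 * lp e - cost e" for e
  have feas: "L0_feasible V L x" using assms(4) by (simp add: L0_optimal_def)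
  have top: "\<P> (L + 1) = {V}"
    and loop: "\<And>t. t \<in> {1..L} \<Longrightarrow> refine_loop (x t) (\<P> (t + 1)) (\<P> t)"
    using assms(5) by (auto simp: ultrametric_violation_distance_output_def)
  \<comment> \<open>The default value 0 at layer \<open>L + 1\<close> agrees with
    \<open>joined\<close>, because the partition there is \<open>{V}\<close>.\<close>
  have id: "integral_distance L \<P> t e = (if ?J t e then 0 else 1)" if "e \<in> pairs V" for t e
    using that top by (auto simp: integral_distance_def joined_def pairs_def)
  have J_mono: "?J t e" if "1 \<le> s" "s \<le> t" "t \<le> L + 1" "?J s e" for s t e
    using that(2,3)
  proof (induction t rule: dec_induct)
    case (step n)
    then show ?case using refine_loop_joined[OF loop[of n]] that(1) by auto
  qed (rule that(4))
  have \<tau>: "\<tau> e \<in> {1..L}" if "e \<in> pairs V" for e using assms(3) that .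
  have lp_ge: "1 - x (\<tau> e) e \<le> lp e" "x (\<tau> e + 1) e \<le> lp e" if "e \<in> pairs V" for e
    using L0_feasible_bounds[OF feas that \<tau>[OF that]] by (auto simp: lp_def)
  \<comment> \<open>Cost 2 would require a pair joined in layer \<open>\<tau> e\<close> but
    separated in the coarser layer above it.\<close>
  have cost_le: "cost e \<le> 1" if "e \<in> pairs V" for e
    using J_mono[of "\<tau> e" "\<tau> e + 1" e] \<tau>[OF that] by (auto simp: cost_def id[OF that])
  have charge_le: "charge (x s e) \<le> w e"
    if e: "e \<in> pairs V" and s: "s \<in> {1..L}" and J: "?J (s + 1) e" "\<not> ?J s e"
      and half: "\<And>t. \<lbrakk>s < t; t \<le> L; ?J t e\<rbrakk> \<Longrightarrow> x t e < 1/2" for e s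
  proof -
    consider "\<tau> e < s" | "\<tau> e = s" | "\<tau> e > s" by linarith
    then show ?thesis
    proof cases
      case 1
      then have "x s e \<le> x (\<tau> e + 1) e"
        using s by (intro L0_feasible_antimono[OF feas e]) auto
      then show ?thesis using lp_ge[OF e] cost_le[OF e] by (auto simp: charge_def w_def)
    next
      case 2
      then have "cost e = 0" using J by (simp add: cost_def id[OF e])
      moreover have "1 - x s e \<le> lp e" using lp_ge(1)[OF e] 2 by simp
      ultimately show ?thesis by (simp add: charge_def w_def)
    next
      case 3
      then have "?J (\<tau> e) e" using J_mono[of "s + 1"] J(1) \<tau>[OF e] by simp
      then have "x (\<tau> e) e < 1/2" using half 3 \<tau>[OF e] by auto
      then show ?thesis using lp_ge[OF e] cost_le[OF e] by (auto simp: charge_def w_def)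
    qed
  qed
  \<comment> \<open>Induction from layer \<open>L + 1\<close> downwards. The bound 1/2 for joined
    pairs is carried along for all layers already processed, since \<open>charge_le\<close> needs it
    at \<open>\<tau> e\<close> when that layer lies above the separating one.\<close>
  have inv: "pairwise disjnt (\<P> t) \<and> \<Union>(\<P> t) \<subseteq> V
      \<and> (\<forall>r e. t \<le> r \<longrightarrow> r \<le> L \<longrightarrow> e \<in> pairs V \<longrightarrow> ?J r e \<longrightarrow> x r e < 1/2)
      \<and> 0 \<le> (\<Sum>e\<in>{e \<in> pairs V. \<not> ?J t e}. w e)" if "t \<le> L + 1" "1 \<le> t" for t
    using that
  proof (induction t rule: inc_induct)
    case base
    have "{e \<in> pairs V. \<not> ?J (L + 1) e} = {}" using top by (auto simp: joined_def pairs_def)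
    then have "(\<Sum>e\<in>{e \<in> pairs V. \<not> ?J (L + 1) e}. w e) = 0" by (simp only: sum.empty)
    then show ?case using top by auto
  next
    case (step t)
    then have t: "t \<in> {1..L}" by auto
    interpret unit_pseudometric V "x t"
      using feas assms(1) t by (rule L0_feasible_unit_pseudometric)
    from step have IH: "pairwise disjnt (\<P> (t + 1))" "\<Union>(\<P> (t + 1)) \<subseteq> V"
      "\<And>r e. \<lbrakk>t < r; r \<le> L; e \<in> pairs V; ?J r e\<rbrakk> \<Longrightarrow> x r e < 1/2"
      "0 \<le> (\<Sum>e\<in>{e \<in> pairs V. \<not> ?J (t + 1) e}. w e)" by auto
    have res: "pairwise disjnt (\<P> t) \<and> \<Union>(\<P> t) \<subseteq> V
        \<and> 0 \<le> (\<Sum>e\<in>{e \<in> pairs V. ?J (t + 1) e \<and> \<not> ?J t e}. w e)"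
      using charge_le t IH(3)
      by (intro refine_loop_weight_nonneg[OF loop[OF t] IH(1,2)]) blast
    have "{e \<in> pairs V. \<not> ?J t e} =
        {e \<in> pairs V. \<not> ?J (t + 1) e} \<union> {e \<in> pairs V. ?J (t + 1) e \<and> \<not> ?J t e}"
      using refine_loop_joined[OF loop[OF t]] by blast
    then have "(\<Sum>e\<in>{e \<in> pairs V. \<not> ?J t e}. w e) =
        (\<Sum>e\<in>{e \<in> pairs V. \<not> ?J (t + 1) e}. w e)
        + (\<Sum>e\<in>{e \<in> pairs V. ?J (t + 1) e \<and> \<not> ?J t e}. w e)"
      using finite_pairs[OF assms(1)] by (simp only:) (rule sum.union_disjoint, auto)
    then have "0 \<le> (\<Sum>e\<in>{e \<in> pairs V. \<not> ?J t e}. w e)" using res IH(4) by linarith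
    moreover have "x r e < 1/2" if "t \<le> r" "r \<le> L" "e \<in> pairs V" "?J r e" for r e
      using that IH(3) refine_loop_joined_less_half[OF loop[OF t] _ that(3) _ assms(1)] res
      by (cases "r = t") auto
    ultimately show ?case using res by blast
  qed
  \<comment> \<open>Joined in layer 1 means never separated: the cost is at most 1, while the LP
    pays more than 1/2 in layer \<open>\<tau> e\<close>.\<close>
  have "0 \<le> w e" if e: "e \<in> pairs V" and J: "?J 1 e" for e
  proof -
    have "?J (\<tau> e) e" using J_mono[of 1] J \<tau>[OF e] by simp
    then have "x (\<tau> e) e < 1/2" using inv[of 1] \<tau>[OF e] e by auto
    then show ?thesis using lp_ge[OF e] cost_le[OF e] by (auto simp: w_def)
  qed
  then have "0 \<le> (\<Sum>e\<in>{e \<in> pairs V. ?J 1 e}. w e)" by (intro sum_nonneg) auto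
  moreover have "0 \<le> (\<Sum>e\<in>{e \<in> pairs V. \<not> ?J 1 e}. w e)" using inv[of 1] by simp
  moreover have "pairs V = {e \<in> pairs V. ?J 1 e} \<union> {e \<in> pairs V. \<not> ?J 1 e}" by blast
  then have "(\<Sum>e\<in>pairs V. w e) =
      (\<Sum>e\<in>{e \<in> pairs V. ?J 1 e}. w e) + (\<Sum>e\<in>{e \<in> pairs V. \<not> ?J 1 e}. w e)"
    using finite_pairs[OF assms(1)] by (subst sum.union_disjoint[symmetric]) auto
  ultimately have "0 \<le> (\<Sum>e\<in>pairs V. w e)" by linarith
  then have "(\<Sum>e\<in>pairs V. cost e) \<le> 5 * (\<Sum>e\<in>pairs V. lp e)"
    by (simp add: w_def sum_subtractf sum_distrib_left)
  then show ?thesis unfolding cost_def lp_def .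
qed

end
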